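(* Let $f:\mathbb{R}^n\to\mathbb{R}$ be continuously differentiable, and let $\{x_k\}_{k\ge 1}$, $\{g_k\}_{k\ge1}$, $\{d_k\}_{k\ge1}$ be generated by the conjugate gradient method with update parameter $\beta_k=\beta_k^{AZHS}$ (as described in the context), where each step size $\alpha_k>0$ satisfies the strong Wolfe--Powell conditions with parameters $0<\delta<\tfrac12$ and $\delta<\sigma<1$. If $\sigma\in(0,0.5)$, then the sufficient descent condition holds: there exists a constant $c>0$ such that $$g_k^T d_k\le -c\|g_k\|^2\qquad\text{for all } k\ge 1.$$
   Context: Notation: $\|\cdot\|$ is the Euclidean norm, $g_k=\nabla f(x_k)$, $y_{k-1}=g_k-g_{k-1}$, $s_{k-1}=x_k-x_{k-1}$, $\mu_k=\|s_{k-1}\|/\|y_{k-1}\|$. Conjugate gradient method: starting from $x_1\in\mathbb{R}^n$, $x_{k+1}=x_k+\alpha_k d_k$ for $k\ge1$, with $d_1=-g_1$ and $d_k=-g_k+\beta_k d_{k-1}$ for $k\ge2$. Strong Wolfe--Powell (SWP) line search: $\alpha_k>0$ satisfies $f(x_k+\alpha_k d_k)\le f(x_k)+\delta\alpha_k g_k^Td_k$ and $|\nabla f(x_k+\alpha_k d_k)^Td_k|\le\sigma|g_k^Td_k|$. The AZHS parameter, for $k\ge 2$: $$\beta_k^{AZHS}=\begin{cases}\dfrac{\|g_k\|^2-\mu_k|g_k^Tg_{k-1}|}{d_{k-1}^Ty_{k-1}}-\dfrac{\mu_k}{\alpha_{k-1}}\dfrac{g_k^Ts_{k-1}}{d_{k-1}^Ty_{k-1}},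 & \text{if }\|g_k\|^2>\mu_k|g_k^Tg_{k-1}|,\\[2mm] -\dfrac{\mu_k}{\alpha_{k-1}}\dfrac{g_k^Ts_{k-1}}{d_{k-1}^Ty_{k-1}}, & \text{otherwise.}\end{cases}$$ The method is assumed to be well defined and non-terminating, i.e. $y_{k-1}\neq0$ and $d_{k-1}^Ty_{k-1}\ne0$ for all $k\ge2$. *)

theory Defs
  imports "HOL-Analysis.Analysis"
begin

definition gradient :: "('a::euclidean_space \<Rightarrow> real) \<Rightarrow> 'a \<Rightarrow> 'a"
  where "gradient f x = (THE D. GDERIV f x :> D)"

lemma gradient_eqI:
  assumes "GDERIV f x :> D"
  shows "gradient f x = D"
  unfolding gradient_def
proof (rule the_equality)
  show "GDERIV f x :> D" by (rule assms)
next
  fix E assume "GDERIV f x :> E"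
  then have "(\<lambda>h. h \<bullet> E) = (\<lambda>h. h \<bullet> D)"
    using assms has_derivative_unique unfolding gderiv_def by blast
  then have "\<And>h. h \<bullet> E = h \<bullet> D" by meson
  then show "E = D" by (metis inner_commute vector_eq_rdot)
qed

lemma gradient_gderiv:
  assumes "f differentiable (at x)"
  shows "GDERIV f x :> gradient f x"
proof -
  obtain L where L: "(f has_derivative L) (at x)"
    using assms unfolding differentiable_def by blast
  interpret L: bounded_linear L using L by (rule has_derivative_bounded_linear)
  have "L = (\<lambda>h. h \<bullet> adjoint L 1)"
    using adjoint_works[OF L.linear_axioms] by fastforce
  then have "GDERIV f x :> adjoint L 1"
    using L unfolding gderiv_def by simp
  then show ?thesis using gradient_eqI by metis
qed

definition continuously_differentiable :: "('a::euclidean_space \<Rightarrow> real) \<Rightarrow> bool"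
  where "continuously_differentiable f \<longleftrightarrow>
    f differentiable_on UNIV \<and> continuous_on UNIV (gradient f)"

definition strong_wolfe_powell ::
    "('a::euclidean_space \<Rightarrow> real) \<Rightarrow> real \<Rightarrow> real \<Rightarrow> 'a \<Rightarrow> 'a \<Rightarrow> real \<Rightarrow> bool"
  where "strong_wolfe_powell f \<delta> \<sigma> x d \<alpha> \<longleftrightarrow>
    \<alpha> > 0 \<and>
    f (x + \<alpha> *\<^sub>R d) \<le> f x + \<delta> * \<alpha> * (gradient f x \<bullet> d) \<and>
    \<bar>gradient f (x + \<alpha> *\<^sub>R d) \<bullet> d\<bar> \<le> \<sigma> * \<bar>gradient f x \<bullet> d\<bar>"

text \<open>
  All sequences are indexed from 1; their values at index 0 are junk. The definition
  below is meant for \<open>k \<ge> 2\<close>.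
\<close>

definition beta_AZHS ::
    "(nat \<Rightarrow> 'a::euclidean_space) \<Rightarrow> (nat \<Rightarrow> 'a) \<Rightarrow> (nat \<Rightarrow> 'a) \<Rightarrow> (nat \<Rightarrow> real) \<Rightarrow> nat \<Rightarrow> real"
  where "beta_AZHS x g d \<alpha> k =
    (let y = g k - g (k - 1);
         s = x k - x (k - 1);
         \<mu> = norm s / norm y
     in if (norm (g k))\<^sup>2 > \<mu> * \<bar>g k \<bullet> g (k - 1)\<bar>
        then ((norm (g k))\<^sup>2 - \<mu> * \<bar>g k \<bullet> g (k - 1)\<bar>) / (d (k - 1) \<bullet> y)
               - \<mu> / \<alpha> (k - 1) * ((g k \<bullet> s) / (d (k - 1) \<bullet> y))
        else - (\<mu> / \<alpha> (k - 1)) * ((g k \<bullet> s) / (d (k - 1) \<bullet> y)))"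

definition cg_method ::
    "('a::euclidean_space \<Rightarrow> real) \<Rightarrow> (nat \<Rightarrow> 'a) \<Rightarrow> (nat \<Rightarrow> 'a) \<Rightarrow> (nat \<Rightarrow> 'a) \<Rightarrow>
      (nat \<Rightarrow> real) \<Rightarrow> (nat \<Rightarrow> real) \<Rightarrow> bool"
  where "cg_method f x g d \<alpha> \<beta> \<longleftrightarrow>
    (\<forall>k\<ge>1. g k = gradient f (x k)) \<and>
    (\<forall>k\<ge>1. x (k + 1) = x k + \<alpha> k *\<^sub>R d k) \<and>
    d 1 = - g 1 \<and>
    (\<forall>k\<ge>2. d k = - g k + \<beta> k *\<^sub>R d (k - 1))"

end

theory Submission
  imports Defs
begin

text \<open>
  Since \<open>s\<^bsub>k-1\<^esub> = \<alpha>\<^bsub>k-1\<^esub> d\<^bsub>k-1\<^esub>\<close>, the second summand of \<open>\<beta>\<^bsub>k\<^esub>\<close> contributes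
  \<open>- \<mu>\<^bsub>k\<^esub> (g\<^bsub>k\<^esub> \<bullet> d\<^bsub>k-1\<^esub>)\<^sup>2 / (d\<^bsub>k-1\<^esub> \<bullet> y\<^bsub>k-1\<^esub>) \<le> 0\<close> to \<open>g\<^bsub>k\<^esub> \<bullet> d\<^bsub>k\<^esub>\<close>. The numerator of the first
  summand lies between \<open>0\<close> and \<open>\<parallel>g\<^bsub>k\<^esub>\<parallel>\<^sup>2\<close>, and the curvature condition gives
  \<open>g\<^bsub>k\<^esub> \<bullet> d\<^bsub>k-1\<^esub> / (d\<^bsub>k-1\<^esub> \<bullet> y\<^bsub>k-1\<^esub>) \<le> \<sigma> / (1 + \<sigma>)\<close>. Hence \<open>c = 1 - \<sigma> / (1 + \<sigma>) = 1 / (1 + \<sigma>)\<close>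
  works.
\<close>

text \<open>Here \<open>t\<close> and \<open>q\<close> stand for the slopes of the new and old
  gradients along the previous direction. The lower bound \<open>t \<ge> \<sigma> * q\<close> gives
  \<open>t - q \<ge> (1 - \<sigma>) * - q \<ge> 0\<close>, strict because \<open>t - q\<close> is
  nonzero. Once denominators are cleared, the ratio bound is just
  \<open>t \<le> - \<sigma> * q\<close>.\<close>

lemma curvature_ratio_le:
  fixes t q \<sigma> :: real
  assumes "q \<le> 0" "\<bar>t\<bar> \<le> \<sigma> * \<bar>q\<bar>" "t - q \<noteq> 0" "0 < \<sigma>" "\<sigma> < 1"
  shows "0 < t - q" "t / (t - q) \<le> \<sigma> / (1 + \<sigma>)"
proof -
  have t: "\<bar>t\<bar> \<le> - \<sigma> * q"
    using assms(1,2) by simp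
  have "0 \<le> (1 - \<sigma>) * - q"
    using assms by (intro mult_nonneg_nonneg) auto
  then have "0 \<le> t - q"
    using t by (simp add: algebra_simps abs_le_iff)
  with assms(3) show "0 < t - q"
    by simp
  moreover have "t * (1 + \<sigma>) \<le> \<sigma> * (t - q)"
    using t by (simp add: algebra_simps abs_le_iff)
  ultimately show "t / (t - q) \<le> \<sigma> / (1 + \<sigma>)"
    using assms(4) by (simp add: divide_le_eq pos_le_divide_eq mult.commute)
qed

lemma beta_AZHS_step:
  assumes s: "x k - x (k - 1) = \<alpha> (k - 1) *\<^sub>R d (k - 1)" and \<alpha>: "\<alpha> (k - 1) \<noteq> 0"
  obtains N \<mu> where "0 \<le> N" "N \<le> (norm (g k))\<^sup>2" "0 \<le> \<mu>"
    "beta_AZHS x g d \<alpha> k = (N - \<mu> * (g k \<bullet> d (k - 1))) / (d (k - 1) \<bullet> (g k - g (k - 1)))"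
proof -
  define \<mu> where "\<mu> = norm (x k - x (k - 1)) / norm (g k - g (k - 1))"
  \<comment> \<open>The positive part merges the two branches of \<open>beta_AZHS\<close>, so no
    case distinction is needed later.\<close>
  define N where "N = max 0 ((norm (g k))\<^sup>2 - \<mu> * \<bar>g k \<bullet> g (k - 1)\<bar>)"
  have \<mu>: "0 \<le> \<mu>"
    by (simp add: \<mu>_def)
  have "\<mu> / \<alpha> (k - 1) * ((g k \<bullet> (x k - x (k - 1))) / D) = \<mu> * (g k \<bullet> d (k - 1)) / D" for D
    using \<alpha> by (simp only: s inner_scaleR_right) simp
  then have "beta_AZHS x g d \<alpha> k = (N - \<mu> * (g k \<bullet> d (k - 1))) / (d (k - 1) \<bullet> (g k - g (k - 1)))"
    unfolding beta_AZHS_def Let_def \<mu>_def[symmetric] N_def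
    by (simp add: diff_divide_distrib)
  moreover have "0 \<le> N" "N \<le> (norm (g k))\<^sup>2"
    using \<mu> by (auto simp: N_def)
  ultimately show thesis
    using \<mu> that by blast
qed

theorem theorem3p1:
  fixes f :: "real ^ 'n \<Rightarrow> real"
    and x g d :: "nat \<Rightarrow> real ^ 'n"
    and \<alpha> \<beta> :: "nat \<Rightarrow> real"
    and \<delta> \<sigma> :: real
  assumes C1: "continuously_differentiable f"
    and cg: "cg_method f x g d \<alpha> \<beta>"
    and beta: "\<And>k. k \<ge> 2 \<Longrightarrow> \<beta> k = beta_AZHS x g d \<alpha> k"
    and y_nonzero: "\<And>k. k \<ge> 2 \<Longrightarrow> g k - g (k - 1) \<noteq> 0"
    and dy_nonzero: "\<And>k. k \<ge> 2 \<Longrightarrow> d (k - 1) \<bullet> (g k - g (k - 1)) \<noteq> 0"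
    and delta: "0 < \<delta>" "\<delta> < 1/2"
    and sigma: "\<delta> < \<sigma>" "\<sigma> < 1"
    and swp: "\<And>k. k \<ge> 1 \<Longrightarrow> strong_wolfe_powell f \<delta> \<sigma> (x k) (d k) (\<alpha> k)"
    and sigma_half: "\<sigma> \<in> {0<..<1/2}"
  shows "\<exists>c>0. \<forall>k\<ge>1. g k \<bullet> d k \<le> - c * (norm (g k))\<^sup>2"
proof (intro exI conjI allI impI)
  have "0 < \<sigma>"
    using delta sigma by simp
  define c where "c = 1 - \<sigma> / (1 + \<sigma>)"
  show "0 < c"
    using \<open>0 < \<sigma>\<close> by (simp add: c_def field_simps)
  fix k :: nat
  assume "1 \<le> k"
  then show "g k \<bullet> d k \<le> - c * (norm (g k))\<^sup>2"
  proof (induction k rule: dec_induct)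
    case base
    have "d 1 = - g 1"
      using cg by (simp add: cg_method_def)
    moreover have "c \<le> 1"
      using \<open>0 < \<sigma>\<close> by (simp add: c_def)
    ultimately show ?case
      using mult_right_mono[of c 1 "(norm (g 1))\<^sup>2"] by (simp add: power2_norm_eq_inner)
  next
    case (step n)
    let ?t = "g (Suc n) \<bullet> d n" and ?q = "g n \<bullet> d n" and ?G = "(norm (g (Suc n)))\<^sup>2"
    have n: "n \<ge> 1" and g: "g n = gradient f (x n)" "g (Suc n) = gradient f (x (Suc n))"
      and x: "x (Suc n) = x n + \<alpha> n *\<^sub>R d n"
      and d: "d (Suc n) = - g (Suc n) + \<beta> (Suc n) *\<^sub>R d n"
      using step.hyps cg by (auto simp: cg_method_def)
    have \<alpha>: "\<alpha> n > 0" and curv: "\<bar>?t\<bar> \<le> \<sigma> * \<bar>?q\<bar>"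
      using swp[OF n] by (auto simp: strong_wolfe_powell_def g x)
    have "0 \<le> c * (norm (g n))\<^sup>2"
      using \<open>0 < c\<close> by simp
    \<comment> \<open>The induction hypothesis enters only through this sign; the constant
      \<open>c\<close> therefore does not degrade with \<open>k\<close>.\<close>
    then have q: "?q \<le> 0"
      using step.IH by simp
    have D: "d n \<bullet> (g (Suc n) - g n) = ?t - ?q"
      by (simp add: inner_diff_right inner_commute)
    have "?t - ?q \<noteq> 0"
      using dy_nonzero[of "Suc n"] n D by simp
    note ratio = curvature_ratio_le[OF q curv this \<open>0 < \<sigma>\<close> sigma(2)]
    obtain N \<mu> where N: "0 \<le> N" "N \<le> ?G" and \<mu>: "0 \<le> \<mu>"
      and \<beta>: "\<beta> (Suc n) = (N - \<mu> * ?t) / (?t - ?q)"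
      using beta_AZHS_step[of x "Suc n" \<alpha> d g] beta[of "Suc n"] n \<alpha> x D by auto
    have "\<beta> (Suc n) * ?t = N * (?t / (?t - ?q)) - \<mu> * ?t\<^sup>2 / (?t - ?q)"
      by (simp add: \<beta> power2_eq_square diff_divide_distrib algebra_simps)
    also have "\<dots> \<le> N * (?t / (?t - ?q))"
      using \<mu> ratio(1) by simp
    \<comment> \<open>The ratio may be negative, so it is bounded first; \<open>N\<close> can then
      be enlarged against a positive factor.\<close>
    also have "\<dots> \<le> N * (\<sigma> / (1 + \<sigma>))"
      using ratio(2) N(1) by (rule mult_left_mono)
    also have "\<dots> \<le> ?G * (\<sigma> / (1 + \<sigma>))"
      using N(2) \<open>0 < \<sigma>\<close> by (intro mult_right_mono) auto
    finally have "\<beta> (Suc n) * ?t \<le> ?G * (\<sigma> / (1 + \<sigma>))" .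
    then show ?case
      by (simp add: d c_def inner_add_right power2_norm_eq_inner algebra_simps)
  qed
qed

end
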